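(* Let $S:\mathbb{R}^m\times\mathbb{R}^n\to\mathbb{R}^q$ be bilinear with lifted operator $\mathscr{S}$. Let $\mathcal{K}'=\{\lambda xy^T:x\in\{-1,1\}^m,y\in\{-1,1\}^n,\lambda\in\mathbb{R}\}$, $\mathcal{M}=\mathcal{K}'-\mathcal{K}'$, and assume $\mathcal{N}(\mathscr{S},1)\cap\mathcal{M}=\{0\}$. Let $\mathbf{M}=xy^T$ be a random rank one matrix where the components of $x\in\mathbb{R}^m$ and of $y\in\mathbb{R}^n$ are drawn independently from the symmetric Bernoulli distribution. Let $\mathcal{G}(k)=\{Y\in\mathbb{R}^{k\times2}:Y^TY=I\}$ and $\mathcal{D}(k)=\{[y_1,y_2]\in\mathbb{R}^{k\times2}:\max_j\|y_j\|_2\le1\}$. Let $\mathcal{G}_c=\{Y\in\mathcal{G}(m):\mathcal{C}(Y)=\mathcal{C}(X)\text{ for some }X\in\mathcal{N}(\mathscr{S},2)\cap\mathcal{M}\setminus\{0\}\}$ and $\mathcal{G}_r=\{Y\in\mathcal{G}(n):\mathcal{C}(Y)=\mathcal{R}(X)\text{ for some }X\in\mathcal{N}(\mathscr{S},2)\cap\mathcal{M}\setminus\{0\}\}$. Fix $\epsilon$ with $1>\epsilon\ge\epsilon_0>0$, let $p_c\log\Theta(1/\epsilon)$ denote the metric entropy of $\mathcal{G}_c$ with respect to $\epsilon\mathcal{D}(m)$ and $p_r\log\Theta(1/\epsilon)$ that of $\mathcal{G}_r$ with respect to $\epsilon\mathcal{D}(n)$, and let $p=p_c+p_r$. For any constant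 $\delta'\in(0,1-2\epsilon^2)$, set $\delta=1-(\sqrt{1-\delta'}-\sqrt2\epsilon)^2$. Then with probability greater than $1-16\exp\big[p\log\Theta(1/\epsilon)-(m+n)\frac{1-\delta}{4}\big]$, for every $X\in\mathcal{N}(\mathscr{S},2)\cap\mathcal{M}\setminus\{0\}$ either $x\notin\mathcal{C}(X)$ or $y\notin\mathcal{R}(X)$.
   Context: For $j=1,\dots,q$ let $S_j$ be the unique matrix with $(S(x,y))_j=x^TS_jy$; the lifted operator is $(\mathscr{S}(W))_j=\operatorname{tr}(S_j^TW)$. $\mathcal{N}(\mathscr{S},k)=\{X:\operatorname{rank}(X)\le k,\ \mathscr{S}(X)=0\}$; $\mathcal{K}'-\mathcal{K}'=\{X_1-X_2:X_1,X_2\in\mathcal{K}'\}$. $\mathcal{C}(X)$, $\mathcal{R}(X)$ are column and row spaces. Symmetric Bernoulli: $\pm1$ each with probability $1/2$. The metric entropy of a set with respect to $\epsilon\mathcal{D}$ is the log of the minimum number of translates of $\epsilon\mathcal{D}$ covering it; the paper writes these as $p_c\log\Theta(1/\epsilon)$, $p_r\log\Theta(1/\epsilon)$, and in the bound $\exp[p\log\Theta(1/\epsilon)]$ denotes the product of the two covering numbers. *)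

theory Defs
  imports "HOL-Analysis.Analysis" "HOL-Probability.Probability"
begin

text \<open>Matrices in R^{m x n} are rendered as real^'n^'m (rows indexed by 'm).\<close>

text \<open>The matrix S_j with (S(x,y))_j = x^T S_j y, i.e. (S_j)_{ik} = (S(e_i,e_k))_j.\<close>
definition Smat :: "(real^'m \<Rightarrow> real^'n \<Rightarrow> real^'q) \<Rightarrow> 'q \<Rightarrow> real^'n^'m" where
  "Smat S j = (\<chi> i k. (S (axis i 1) (axis k 1)) $ j)"

text \<open>Lifted operator: (liftS S W)_j = tr(S_j^T W).\<close>
definition liftS :: "(real^'m \<Rightarrow> real^'n \<Rightarrow> real^'q) \<Rightarrow> real^'n^'m \<Rightarrow> real^'q" where
  "liftS S W = (\<chi> j. trace (transpose (Smat S j) ** W))"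

text \<open>N(S,k) = {X : rank X <= k, S(X) = 0}.\<close>
definition Nset :: "(real^'m \<Rightarrow> real^'n \<Rightarrow> real^'q) \<Rightarrow> nat \<Rightarrow> (real^'n^'m) set" where
  "Nset S k = {X. rank X \<le> k \<and> liftS S X = 0}"

definition outer :: "real^'m \<Rightarrow> real^'n \<Rightarrow> real^'n^'m" where
  "outer x y = (\<chi> i j. x $ i * y $ j)"

definition signvecs :: "(real^'k) set" where
  "signvecs = {x. \<forall>i. x $ i = 1 \<or> x $ i = -1}"

text \<open>K' = {lambda x y^T : x, y sign vectors, lambda real}.\<close>
definition Kprime :: "(real^'n^'m) set" where
  "Kprime = {c *\<^sub>R outer x y | c x y. x \<in> signvecs \<and> y \<in> signvecs}"

text \<open>M = K' - K'.\<close>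
definition Mset :: "(real^'n^'m) set" where
  "Mset = {X1 - X2 | X1 X2. X1 \<in> Kprime \<and> X2 \<in> Kprime}"

text \<open>Column space and row space.\<close>
definition colsp :: "real^'n^'m \<Rightarrow> (real^'m) set" where
  "colsp X = span (columns X)"

definition rowsp :: "real^'n^'m \<Rightarrow> (real^'n) set" where
  "rowsp X = span (rows X)"

text \<open>G(k) = {Y in R^{k x 2} : Y^T Y = I}.\<close>
definition Gset :: "(real^2^'k) set" where
  "Gset = {Y. transpose Y ** Y = mat 1}"

text \<open>D(k) = {[y1,y2] in R^{k x 2} : max_j ||y_j|| <= 1}.\<close>
definition Dset :: "(real^2^'k) set" where
  "Dset = {Y. \<forall>j. norm (column j Y) \<le> 1}"

definition Gc :: "(real^'m \<Rightarrow> real^'n \<Rightarrow> real^'q) \<Rightarrow> (real^2^'m) set" where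
  "Gc S = {Y \<in> Gset. \<exists>X \<in> Nset S 2 \<inter> Mset - {0}. colsp Y = colsp X}"

definition Gr :: "(real^'m \<Rightarrow> real^'n \<Rightarrow> real^'q) \<Rightarrow> (real^2^'n) set" where
  "Gr S = {Y \<in> Gset. \<exists>X \<in> Nset S 2 \<inter> Mset - {0}. colsp Y = rowsp X}"

text \<open>Covering number: minimum number of translates of D covering A
  (the metric entropy is its logarithm).\<close>
definition covnum :: "'a::ab_group_add set \<Rightarrow> 'a set \<Rightarrow> nat" where
  "covnum A D = (LEAST N. \<exists>F. finite F \<and> card F = N \<and> A \<subseteq> (\<Union>c\<in>F. (\<lambda>d. c + d) ` D))"

end

theory Submission
  imports Defs "HOL-Probability.Hoeffding"
begin

text \<open>
  Only one property of \<open>S\<close> is used: by the hypothesis on \<open>\<N>(\<S>,1)\<close>, every nonzero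
  \<open>X \<in> \<N>(\<S>,2) \<inter> \<M>\<close> has rank exactly 2, so its column space is spanned by a frame in
  \<open>\<G>\<^sub>c\<close> and its row space by a frame in \<open>\<G>\<^sub>r\<close>. If a sign vector \<open>x\<close> lies in the span of a frame
  \<open>Y = C + \<epsilon>D\<close> with \<open>D \<in> \<D>\<close>, then the projection of \<open>x\<close> onto the span of the cover centre
  \<open>C\<close> keeps at least the fraction \<open>1 - 2\<epsilon>\<^sup>2\<close> of \<open>\<parallel>x\<parallel>\<^sup>2 = m\<close>, so \<open>x\<close> has a large inner
  product with one of at most two orthonormal vectors. By Hoeffding's inequality this happens
  for a fraction at most \<open>4 exp(-m(1 - 2\<epsilon>\<^sup>2)/4)\<close> of the sign vectors, for each of the
  finitely many centres. A union bound over the centres for \<open>x\<close> and for \<open>y\<close>, which are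
  independent, gives the probability bound, and \<open>1 - \<delta> < 1 - 2\<epsilon>\<^sup>2\<close> makes it strict.
\<close>

section \<open>Sign vectors\<close>

lemma signvecs_eq_image_PiE:
  "(signvecs :: (real^'k) set) = vec_lambda ` (UNIV \<rightarrow>\<^sub>E {-1, 1})"
proof (rule set_eqI, rule iffI)
  fix x :: "real^'k"
  assume "x \<in> signvecs"
  then have "vec_nth x \<in> UNIV \<rightarrow>\<^sub>E {-1, 1}"
    by (auto simp: signvecs_def)
  then show "x \<in> vec_lambda ` (UNIV \<rightarrow>\<^sub>E {-1, 1})"
    by (metis image_eqI vec_nth_inverse)
qed (auto simp: signvecs_def PiE_iff)

lemma inj_on_vec_lambda: "inj_on vec_lambda A"
  by (intro inj_onI) (metis vec_lambda_inverse UNIV_I)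

lemma finite_signvecs: "finite (signvecs :: (real^'k) set)"
  unfolding signvecs_eq_image_PiE by (intro finite_imageI finite_PiE) auto

lemma card_signvecs: "card (signvecs :: (real^'k) set) = 2 ^ CARD('k)"
  unfolding signvecs_eq_image_PiE by (simp add: card_image inj_on_vec_lambda card_PiE numeral_2_eq_2)

lemma signvecs_ne_empty: "signvecs \<noteq> {}"
proof -
  have "1 \<in> signvecs"
    by (simp add: signvecs_def)
  then show ?thesis
    by blast
qed

lemma sum_prod_signvecs:
  fixes f :: "'k::finite \<Rightarrow> real \<Rightarrow> real"
  shows "(\<Sum>x\<in>signvecs. \<Prod>i\<in>UNIV. f i (x $ i)) = (\<Prod>i\<in>UNIV. f i 1 + f i (-1))"
proof -
  have "(\<Sum>x\<in>signvecs. \<Prod>i\<in>UNIV. f i (x $ i))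
      = (\<Sum>g\<in>UNIV \<rightarrow>\<^sub>E {-1, 1}. \<Prod>i\<in>UNIV. f i (g i))"
    unfolding signvecs_eq_image_PiE by (subst sum.reindex[OF inj_on_vec_lambda]) simp
  also have "\<dots> = (\<Prod>i\<in>UNIV. \<Sum>y\<in>{-1, 1}. f i y)"
    by (rule prod_sum_PiE[symmetric]) auto
  finally show ?thesis by (simp add: add.commute)
qed

lemma power2_norm_signvec:
  assumes "x \<in> (signvecs :: (real^'k) set)"
  shows "(norm x)\<^sup>2 = real CARD('k)"
proof -
  have "x $ i = 1 \<or> x $ i = -1" for i
    using assms by (simp add: signvecs_def)
  then have "x $ i * x $ i = 1" for i
    by (metis mult_1 mult_minus_left minus_minus)
  then show ?thesis
    by (simp add: power2_norm_eq_inner inner_vec_def)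
qed

lemma exp_plus_exp_minus_le: "exp a + exp (- a) \<le> 2 * exp (a\<^sup>2 / 2)" for a :: real
proof -
  define b where "b = \<bar>a\<bar>"
  have "- (2 * b) * (1/2) + ln (1 + (1/2) * (exp (2 * b) - 1)) \<le> (2 * b)\<^sup>2 / 8"
    using Hoeffdings_lemma_aux[of "2 * b" "1/2"] by (simp add: b_def)
  then have "ln ((exp b * exp b + 1) / 2) \<le> b + a\<^sup>2 / 2"
    by (simp add: b_def power2_eq_square exp_add[symmetric] field_simps)
  moreover have "(exp b * exp b + 1) / 2 > 0"
    by (simp add: add_pos_pos)
  ultimately have "(exp b * exp b + 1) / 2 \<le> exp b * exp (a\<^sup>2 / 2)"
    by (metis exp_add exp_le_cancel_iff exp_ln)
  then have "exp b + exp (- b) \<le> 2 * exp (a\<^sup>2 / 2)"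
    by (simp add: exp_minus field_simps)
  then show ?thesis
    by (cases "a \<ge> 0") (auto simp: b_def)
qed

text \<open>Chernoff's method: \<open>1 \<le> exp (l\<langle>u,x\<rangle> - l\<^sup>2)\<close> on the counted set, and the sum of the
  right-hand side over all sign vectors factorizes over the coordinates.\<close>
lemma card_signvecs_inner_ge:
  fixes u :: "real^'k"
  assumes u: "norm u = 1" and l: "l \<ge> 0"
  shows "real (card {x \<in> signvecs. l \<le> inner u x}) \<le> 2 ^ CARD('k) * exp (- l\<^sup>2 / 2)"
proof -
  have "real (card {x \<in> signvecs. l \<le> inner u x}) = (\<Sum>x\<in>{x \<in> signvecs. l \<le> inner u x}. 1)"
    by simp
  also have "\<dots> \<le> (\<Sum>x\<in>{x \<in> signvecs. l \<le> inner u x}. exp (l * inner u x - l\<^sup>2))"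
    using l by (intro sum_mono) (simp add: power2_eq_square mult_left_mono)
  also have "\<dots> \<le> (\<Sum>x\<in>signvecs. exp (l * inner u x - l\<^sup>2))"
    by (rule sum_mono2[OF finite_signvecs]) auto
  also have "\<dots> = (\<Sum>x\<in>signvecs. exp (- l\<^sup>2) * exp (\<Sum>i\<in>UNIV. l * u $ i * x $ i))"
    by (simp add: inner_vec_def sum_distrib_left mult.assoc exp_add[symmetric])
  also have "\<dots> = exp (- l\<^sup>2) * (\<Sum>x\<in>signvecs. \<Prod>i\<in>UNIV. (\<lambda>i y. exp (l * u $ i * y)) i (x $ i))"
    by (simp add: exp_sum sum_distrib_left)
  also have "\<dots> = exp (- l\<^sup>2) * (\<Prod>i\<in>UNIV. exp (l * u $ i) + exp (- (l * u $ i)))"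
    by (subst sum_prod_signvecs) simp
  also have "\<dots> \<le> exp (- l\<^sup>2) * (\<Prod>i\<in>UNIV. 2 * exp ((l * u $ i)\<^sup>2 / 2))"
    by (intro mult_left_mono prod_mono conjI exp_plus_exp_minus_le) (auto intro: add_nonneg_nonneg)
  also have "\<dots> = exp (- l\<^sup>2) * (2 ^ CARD('k) * exp (l\<^sup>2 / 2 * (\<Sum>i\<in>UNIV. u $ i * u $ i)))"
    by (simp add: prod.distrib exp_sum sum_distrib_left power2_eq_square sum_divide_distrib
        algebra_simps)
  also have "(\<Sum>i\<in>UNIV. u $ i * u $ i) = 1"
    using u by (simp add: norm_eq_1 inner_vec_def)
  finally show ?thesis
    by (simp add: exp_add[symmetric] algebra_simps)
qed

lemma card_signvecs_abs_inner_ge: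
  fixes u :: "real^'k"
  assumes "norm u = 1" and "l \<ge> 0"
  shows "real (card {x \<in> signvecs. l \<le> \<bar>inner u x\<bar>}) \<le> 2 * 2 ^ CARD('k) * exp (- l\<^sup>2 / 2)"
proof -
  have "{x \<in> signvecs. l \<le> \<bar>inner u x\<bar>}
      = {x \<in> signvecs. l \<le> inner u x} \<union> {x \<in> signvecs. l \<le> inner (- u) x}"
    by (auto simp: abs_if)
  then have "real (card {x \<in> signvecs. l \<le> \<bar>inner u x\<bar>})
      \<le> real (card {x \<in> signvecs. l \<le> inner u x}) + real (card {x \<in> signvecs. l \<le> inner (- u) x})"
    by (simp only: of_nat_add[symmetric] of_nat_le_iff card_Un_le)
  also have "\<dots> \<le> 2 ^ CARD('k) * exp (- l\<^sup>2 / 2) + 2 ^ CARD('k) * exp (- l\<^sup>2 / 2)"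
    using assms by (intro add_mono card_signvecs_inner_ge) auto
  finally show ?thesis
    by simp
qed

lemma card_signvecs_exists_abs_inner_ge:
  fixes B :: "(real^'k) set"
  assumes "finite B" and "\<And>u. u \<in> B \<Longrightarrow> norm u = 1" and "l \<ge> 0"
  shows "real (card {x \<in> signvecs. \<exists>u\<in>B. l \<le> \<bar>inner u x\<bar>})
      \<le> card B * (2 * 2 ^ CARD('k) * exp (- l\<^sup>2 / 2))"
proof -
  have "{x \<in> signvecs. \<exists>u\<in>B. l \<le> \<bar>inner u x\<bar>} = (\<Union>u\<in>B. {x \<in> signvecs. l \<le> \<bar>inner u x\<bar>})"
    by auto
  then have "real (card {x \<in> signvecs. \<exists>u\<in>B. l \<le> \<bar>inner u x\<bar>})
      \<le> (\<Sum>u\<in>B. real (card {x \<in> signvecs. l \<le> \<bar>inner u x\<bar>}))"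
    by (simp only: of_nat_sum[symmetric] of_nat_le_iff card_UN_le[OF assms(1)])
  also have "\<dots> \<le> (\<Sum>u\<in>B. 2 * 2 ^ CARD('k) * exp (- l\<^sup>2 / 2))"
    using assms by (intro sum_mono card_signvecs_abs_inner_ge) auto
  finally show ?thesis
    by simp
qed

section \<open>Orthonormal frames\<close>

lemma columns_2: "columns (A :: real^2^'k) = {column 1 A, column 2 A}"
  by (auto simp: columns_def UNIV_2)

lemma transpose_mult_self_nth:
  "(transpose A ** A) $ i $ j = inner (column i A) (column j A)"
  by (simp add: matrix_matrix_mult_def transpose_def column_def inner_vec_def)

lemma Gset_iff_orthonormal_columns:
  "Y \<in> Gset \<longleftrightarrow> (\<forall>i j. inner (column i Y) (column j Y) = (if i = j then 1 else 0))"
  by (simp add: Gset_def vec_eq_iff transpose_mult_self_nth mat_def)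

lemma power2_norm_matrix_eq_sum_columns:
  fixes A :: "real^'n^'m"
  shows "(norm A)\<^sup>2 = (\<Sum>j\<in>UNIV. (norm (column j A))\<^sup>2)"
  unfolding power2_norm_eq_inner inner_vec_def column_def
  by (simp add: sum.swap[of _ "UNIV :: 'm set"])

lemma norm_column_le: "norm (column j A) \<le> norm (A :: real^'n^'m)"
  unfolding norm_vec_def[of "column j A"] norm_vec_def[of A]
  by (rule L2_set_mono) (simp_all add: column_def component_le_norm_cart)

lemma norm_Gset:
  assumes "Y \<in> Gset"
  shows "norm (Y :: real^2^'k) = sqrt 2"
proof -
  have "(norm (column j Y))\<^sup>2 = 1" for j
    using assms by (simp add: Gset_iff_orthonormal_columns power2_norm_eq_inner)
  then have "(norm Y)\<^sup>2 = 2"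
    by (simp add: power2_norm_matrix_eq_sum_columns)
  then show ?thesis
    by (metis norm_ge_zero real_sqrt_unique)
qed

lemma bounded_Gset: "bounded (Gset :: (real^2^'k) set)"
  by (metis bounded_iff norm_Gset order_refl)

lemma Gset_colsp_eq_if_rank_2:
  fixes A :: "real^'n^'m"
  assumes "rank A = 2"
  obtains Y :: "real^2^'m" where "Y \<in> Gset" and "colsp Y = colsp A"
proof -
  obtain B where B: "pairwise orthogonal B" "\<And>x. x \<in> B \<Longrightarrow> norm x = 1"
      "card B = dim (span (columns A))" "span B = span (columns A)"
    using orthonormal_basis_subspace[OF subspace_span] by metis
  have "card B = 2"
    using B(3) assms by (simp add: column_rank_def)
  then obtain u1 u2 where u: "B = {u1, u2}" "u1 \<noteq> u2"
    by (auto simp: card_2_iff)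
  define Y :: "real^2^'m" where "Y = (\<chi> i j. if j = 1 then u1 $ i else u2 $ i)"
  have columns_Y: "column 1 Y = u1" "column 2 Y = u2"
    by (simp_all add: Y_def column_def vec_eq_iff)
  have "inner u1 u1 = 1" "inner u2 u2 = 1" "inner u1 u2 = 0" "inner u2 u1 = 0"
    using B(1,2) u by (auto simp: norm_eq_1 pairwise_def orthogonal_def)
  then have "Y \<in> Gset"
    by (simp add: Gset_iff_orthonormal_columns forall_2 columns_Y)
  moreover have "colsp Y = colsp A"
    unfolding colsp_def columns_2 columns_Y B(4)[symmetric] u ..
  ultimately show thesis
    by (rule that)
qed

lemma orthonormal_basis_span_columns:
  fixes A :: "real^'n^'m"
  obtains B where "finite B" "pairwise orthogonal B" "\<And>u. u \<in> B \<Longrightarrow> norm u = 1"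
    "span B = span (columns A)" "card B \<le> CARD('n)"
proof -
  obtain B where B: "pairwise orthogonal B" "\<And>u. u \<in> B \<Longrightarrow> norm u = 1" "independent B"
      "card B = dim (span (columns A))" "span B = span (columns A)"
    using orthonormal_basis_subspace[OF subspace_span] by metis
  have columns: "columns A = range (\<lambda>i. column i A)"
    by (auto simp: columns_def)
  have "dim (columns A) \<le> card (columns A)"
    by (rule dim_le_card) (auto simp: columns intro: span_base)
  also have "card (columns A) \<le> CARD('n)"
    unfolding columns by (rule card_image_le) simp
  finally have "card B \<le> CARD('n)"
    using B(4) by simp
  with B show thesis
    by (intro that independent_imp_finite)
qed

lemma span_pairE:
  fixes x :: "'a::real_vector"
  assumes "x \<in> span {a, b}"
  obtains s t where "x = s *\<^sub>R a + t *\<^sub>R b"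
proof -
  obtain s where "x - s *\<^sub>R a \<in> span {b}"
    using assms by (auto simp: span_insert)
  then obtain t where "x - s *\<^sub>R a = t *\<^sub>R b"
    by (auto simp: span_singleton)
  then show thesis
    using that[of s t] by (simp add: algebra_simps)
qed

text \<open>Bessel's inequality combined with the best-approximation property of the orthogonal
  projection \<open>p\<close> onto \<open>span B\<close>.\<close>
lemma power2_norm_le_dist_plus_sum_inner:
  fixes x z :: "'a::real_inner"
  assumes fin: "finite B" and orth: "pairwise orthogonal B" and unit: "\<And>u. u \<in> B \<Longrightarrow> norm u = 1"
    and z: "z \<in> span B"
  shows "(norm x)\<^sup>2 \<le> (norm (x - z))\<^sup>2 + (\<Sum>u\<in>B. (inner u x)\<^sup>2)"
proof -
  define p where "p = (\<Sum>u\<in>B. inner u x *\<^sub>R u)"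
  have inner_p: "inner v p = inner v x" if "v \<in> B" for v
  proof -
    have "inner v p = (\<Sum>u\<in>B. inner u x * inner v u)"
      by (simp add: p_def inner_sum_right)
    also have "\<dots> = inner v x * inner v v"
      using orth that by (subst sum.remove[OF fin that], subst sum.neutral)
        (auto simp: pairwise_def orthogonal_def)
    finally show ?thesis
      using unit[OF that] by (simp add: norm_eq_1 inner_commute)
  qed
  have perp: "orthogonal (x - p) w" if "w \<in> span B" for w
  proof (rule orthogonal_to_span[OF that])
    fix v
    assume "v \<in> B"
    then show "orthogonal (x - p) v"
      unfolding orthogonal_def
      by (simp only: inner_diff_left inner_commute[of p v] inner_commute[of x v] inner_p)
  qed
  have p: "p \<in> span B"
    unfolding p_def by (intro span_sum span_scale span_base)
  have "(norm (x - z))\<^sup>2 = (norm (x - p))\<^sup>2 + (norm (p - z))\<^sup>2"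
    using norm_add_Pythagorean[OF perp[of "p - z"]] p z by (simp add: span_diff)
  moreover have "(norm x)\<^sup>2 = (norm (x - p))\<^sup>2 + (norm p)\<^sup>2"
    using norm_add_Pythagorean[OF perp[OF p]] by simp
  moreover have "(norm p)\<^sup>2 = (\<Sum>u\<in>B. (inner u x)\<^sup>2)"
    unfolding p_def using orth
    by (subst norm_sum_Pythagorean[OF fin])
      (auto simp: pairwise_def orthogonal_clauses unit power_mult_distrib)
  ultimately show ?thesis
    by simp
qed

text \<open>If \<open>x\<close> is in the span of a frame \<open>Y\<close> within \<open>e\<close> of \<open>C\<close>, writing \<open>x = s y\<^sub>1 + t y\<^sub>2\<close> and
  \<open>z = s c\<^sub>1 + t c\<^sub>2\<close> gives \<open>\<parallel>x - z\<parallel>\<^sup>2 \<le> e\<^sup>2(\<bar>s\<bar> + \<bar>t\<bar>)\<^sup>2 \<le> 2e\<^sup>2(s\<^sup>2 + t\<^sup>2) = 2e\<^sup>2\<parallel>x\<parallel>\<^sup>2\<close>.\<close>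
lemma power2_norm_le_sum_inner_if_colsp_near:
  fixes Y C D :: "real^2^'k"
  assumes Y: "Y \<in> Gset" "Y = C + e *\<^sub>R D" and D: "D \<in> Dset" and e: "e \<ge> 0"
    and x: "x \<in> colsp Y"
    and B: "finite B" "pairwise orthogonal B" "\<And>u. u \<in> B \<Longrightarrow> norm u = 1"
      "span B = span (columns C)"
  shows "(norm x)\<^sup>2 * (1 - 2 * e\<^sup>2) \<le> (\<Sum>u\<in>B. (inner u x)\<^sup>2)"
proof -
  obtain s t where x_eq: "x = s *\<^sub>R column 1 Y + t *\<^sub>R column 2 Y"
    using x by (auto simp: colsp_def columns_2 elim: span_pairE)
  have "(norm x)\<^sup>2 = s\<^sup>2 + t\<^sup>2"
    using Y(1) unfolding power2_norm_eq_inner x_eq Gset_iff_orthonormal_columns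
    by (simp add: inner_add_left inner_add_right power2_eq_square)
  define z where "z = s *\<^sub>R column 1 C + t *\<^sub>R column 2 C"
  have z: "z \<in> span B"
    unfolding B(4) z_def columns_2 by (intro span_add span_scale span_base) auto
  have "x - z = e *\<^sub>R (s *\<^sub>R column 1 D + t *\<^sub>R column 2 D)"
    by (simp add: x_eq z_def Y(2) column_def vec_eq_iff algebra_simps)
  moreover have "norm (s *\<^sub>R column 1 D + t *\<^sub>R column 2 D) \<le> \<bar>s\<bar> + \<bar>t\<bar>"
  proof -
    have "norm (s *\<^sub>R column 1 D) \<le> \<bar>s\<bar>" "norm (t *\<^sub>R column 2 D) \<le> \<bar>t\<bar>"
      using D by (auto simp: Dset_def intro: mult_left_le)
    then show ?thesis
      using norm_triangle_ineq[of "s *\<^sub>R column 1 D" "t *\<^sub>R column 2 D"] by linarith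
  qed
  ultimately have "norm (x - z) \<le> e * (\<bar>s\<bar> + \<bar>t\<bar>)"
    using e by (simp add: mult_left_mono)
  then have "(norm (x - z))\<^sup>2 \<le> e\<^sup>2 * (\<bar>s\<bar> + \<bar>t\<bar>)\<^sup>2"
    using power_mono[of "norm (x - z)" "e * (\<bar>s\<bar> + \<bar>t\<bar>)" 2] by (simp add: power_mult_distrib)
  also have "\<dots> \<le> e\<^sup>2 * (2 * (s\<^sup>2 + t\<^sup>2))"
    using zero_le_power2[of "\<bar>s\<bar> - \<bar>t\<bar>"]
    by (intro mult_left_mono) (simp_all add: power2_sum power2_diff)
  finally show ?thesis
    using power2_norm_le_dist_plus_sum_inner[OF B(1-3) z, of x] \<open>(norm x)\<^sup>2 = s\<^sup>2 + t\<^sup>2\<close>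
    by (simp add: algebra_simps)
qed

section \<open>Covering numbers\<close>

lemma finite_cover_scaled_Dset:
  fixes G :: "(real^2^'k) set"
  assumes "bounded G" and "e > 0"
  shows "\<exists>F. finite F \<and> G \<subseteq> (\<Union>c\<in>F. (+) c ` (*\<^sub>R) e ` Dset)"
proof -
  obtain F where F: "finite F" "closure G \<subseteq> (\<Union>c\<in>F. ball c e)"
    using compact_closure[THEN iffD2, OF assms(1), unfolded compact_eq_totally_bounded] assms(2)
    by meson
  have "ball c e \<subseteq> (+) c ` (*\<^sub>R) e ` Dset" for c
  proof
    fix Y
    assume "Y \<in> ball c e"
    then have "norm ((1 / e) *\<^sub>R (Y - c)) \<le> 1"
      using assms(2) by (simp add: dist_norm norm_minus_commute divide_le_eq_1)
    then have "norm (column j ((1 / e) *\<^sub>R (Y - c))) \<le> 1" for j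
      using norm_column_le order_trans by blast
    then have "(1 / e) *\<^sub>R (Y - c) \<in> Dset"
      by (simp add: Dset_def)
    moreover have "Y = c + e *\<^sub>R ((1 / e) *\<^sub>R (Y - c))"
      using assms(2) by simp
    ultimately show "Y \<in> (+) c ` (*\<^sub>R) e ` Dset"
      by (intro image_eqI[OF _ imageI]) auto
  qed
  then have "(\<Union>c\<in>F. ball c e) \<subseteq> (\<Union>c\<in>F. (+) c ` (*\<^sub>R) e ` Dset)"
    by (rule SUP_mono')
  then show ?thesis
    using F(1) order_trans[OF order_trans[OF closure_subset F(2)]] by (intro exI conjI)
qed

lemma covnum_cover:
  fixes G :: "(real^2^'k) set"
  assumes "bounded G" and "e > 0"
  obtains F where "finite F" "card F = covnum G ((*\<^sub>R) e ` Dset)"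
    "G \<subseteq> (\<Union>c\<in>F. (+) c ` (*\<^sub>R) e ` Dset)"
proof -
  have "\<exists>N F. finite F \<and> card F = N \<and> G \<subseteq> (\<Union>c\<in>F. (\<lambda>d. c + d) ` (*\<^sub>R) e ` Dset)"
    using finite_cover_scaled_Dset[OF assms] by blast
  from LeastI_ex[OF this] show thesis
    unfolding covnum_def[symmetric] by (elim exE conjE) (rule that)
qed

lemma covnum_pos:
  fixes G :: "(real^2^'k) set"
  assumes "bounded G" and "e > 0" and "G \<noteq> {}"
  shows "covnum G ((*\<^sub>R) e ` Dset) > 0"
proof -
  obtain F where "finite F" "card F = covnum G ((*\<^sub>R) e ` Dset)"
    "G \<subseteq> (\<Union>c\<in>F. (+) c ` (*\<^sub>R) e ` Dset)"
    using covnum_cover[OF assms(1,2)] by blast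
  moreover have "F \<noteq> {}"
    using assms(3) \<open>G \<subseteq> (\<Union>c\<in>F. (+) c ` (*\<^sub>R) e ` Dset)\<close> by auto
  ultimately show ?thesis
    by (metis card_gt_0_iff)
qed

section \<open>Sign vectors near the column spaces of frames\<close>

lemma signvec_abs_inner_ge_if_colsp_near:
  fixes Y C D :: "real^2^'k"
  assumes Y: "Y \<in> Gset" "Y = C + e *\<^sub>R D" and D: "D \<in> Dset" and e: "e \<ge> 0" "2 * e\<^sup>2 < 1"
    and x: "x \<in> signvecs" "x \<in> colsp Y"
    and B: "finite B" "pairwise orthogonal B" "\<And>u. u \<in> B \<Longrightarrow> norm u = 1"
      "span B = span (columns C)" "card B \<le> 2"
  shows "\<exists>u\<in>B. sqrt (real CARD('k) * (1 - 2 * e\<^sup>2) / 2) \<le> \<bar>inner u x\<bar>"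
proof (rule ccontr)
  define L where "L = sqrt (real CARD('k) * (1 - 2 * e\<^sup>2) / 2)"
  have L: "2 * L\<^sup>2 = real CARD('k) * (1 - 2 * e\<^sup>2)"
    using e(2) by (simp add: L_def)
  assume "\<not> (\<exists>u\<in>B. L \<le> \<bar>inner u x\<bar>)"
  then have "\<bar>inner u x\<bar> < L" if "u \<in> B" for u
    using that by auto
  then have small: "(inner u x)\<^sup>2 < L\<^sup>2" if "u \<in> B" for u
    using that power_strict_mono[of "\<bar>inner u x\<bar>" L 2] by simp
  have "(\<Sum>u\<in>B. (inner u x)\<^sup>2) < real CARD('k) * (1 - 2 * e\<^sup>2)"
  proof (cases "B = {}")
    case True
    then show ?thesis
      using e(2) by simp
  next
    case False
    then have "(\<Sum>u\<in>B. (inner u x)\<^sup>2) < card B * L\<^sup>2"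
      using sum_strict_mono[OF B(1) False small] by simp
    also have "\<dots> \<le> 2 * L\<^sup>2"
      using B(5) by (intro mult_right_mono) auto
    finally show ?thesis
      using L by simp
  qed
  moreover have "real CARD('k) * (1 - 2 * e\<^sup>2) \<le> (\<Sum>u\<in>B. (inner u x)\<^sup>2)"
    using power2_norm_le_sum_inner_if_colsp_near[OF Y D e(1) x(2) B(1-4)]
    by (simp add: power2_norm_signvec[OF x(1)])
  ultimately show False
    by simp
qed

lemma card_signvecs_in_colsp_le:
  fixes G :: "(real^2^'k) set"
  assumes G: "G \<subseteq> Gset" and e: "e > 0" "2 * e\<^sup>2 < 1"
  shows "card {x \<in> signvecs. \<exists>Y\<in>G. x \<in> colsp Y} / 2 ^ CARD('k)
    \<le> 4 * real (covnum G ((*\<^sub>R) e ` Dset)) * exp (- (real CARD('k) * (1 - 2 * e\<^sup>2)) / 4)"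
proof -
  define L where "L = sqrt (real CARD('k) * (1 - 2 * e\<^sup>2) / 2)"
  have L: "L \<ge> 0" "exp (- L\<^sup>2 / 2) = exp (- (real CARD('k) * (1 - 2 * e\<^sup>2)) / 4)"
    using e(2) by (simp_all add: L_def)
  obtain F where F: "finite F" "card F = covnum G ((*\<^sub>R) e ` Dset)"
    "G \<subseteq> (\<Union>C\<in>F. (+) C ` (*\<^sub>R) e ` Dset)"
    using covnum_cover[OF bounded_subset[OF bounded_Gset G] e(1)] by blast
  define onb where "onb C B \<longleftrightarrow> finite B \<and> pairwise orthogonal B \<and> (\<forall>u\<in>B. norm u = 1)
      \<and> span B = span (columns C) \<and> card B \<le> 2" for C :: "real^2^'k" and B
  have "\<exists>B. onb C B" for C
  proof -
    obtain B where "finite B" "pairwise orthogonal B" "\<And>u. u \<in> B \<Longrightarrow> norm u = 1"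
      "span B = span (columns C)" "card B \<le> CARD(2)"
      using orthonormal_basis_span_columns[of C] by blast
    then show ?thesis
      by (auto simp: onb_def)
  qed
  define Bf where "Bf C = (SOME B. onb C B)" for C
  have Bf: "finite (Bf C) \<and> pairwise orthogonal (Bf C) \<and> (\<forall>u\<in>Bf C. norm u = 1)
      \<and> span (Bf C) = span (columns C) \<and> card (Bf C) \<le> 2" for C
    using someI_ex[OF \<open>\<exists>B. onb C B\<close>] by (simp add: Bf_def onb_def)
  define Bad where "Bad C = {x \<in> signvecs. \<exists>u\<in>Bf C. L \<le> \<bar>inner u x\<bar>}" for C
  have "{x \<in> signvecs. \<exists>Y\<in>G. x \<in> colsp Y} \<subseteq> (\<Union>C\<in>F. Bad C)"
  proof safe
    fix x Y
    assume x: "x \<in> signvecs" and Y: "Y \<in> G" "x \<in> colsp Y"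
    then obtain C D where C: "C \<in> F" and D: "D \<in> Dset" "Y = C + e *\<^sub>R D"
      using F(3) by blast
    have "\<exists>u\<in>Bf C. L \<le> \<bar>inner u x\<bar>"
      unfolding L_def using Y G e Bf[of C]
      by (intro signvec_abs_inner_ge_if_colsp_near[OF _ D(2) D(1) _ _ x]) auto
    then show "x \<in> (\<Union>C\<in>F. Bad C)"
      using C x by (auto simp: Bad_def)
  qed
  moreover have "finite (\<Union>C\<in>F. Bad C)"
    using F(1) finite_signvecs by (auto simp: Bad_def)
  ultimately have "card {x \<in> signvecs. \<exists>Y\<in>G. x \<in> colsp Y} \<le> card (\<Union>C\<in>F. Bad C)"
    by (intro card_mono)
  also have "\<dots> \<le> (\<Sum>C\<in>F. card (Bad C))"
    using F(1) by (rule card_UN_le)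
  finally have "real (card {x \<in> signvecs. \<exists>Y\<in>G. x \<in> colsp Y}) \<le> (\<Sum>C\<in>F. card (Bad C))"
    by linarith
  also have "real (\<Sum>C\<in>F. card (Bad C)) \<le> (\<Sum>C\<in>F. 2 * (2 * 2 ^ CARD('k) * exp (- L\<^sup>2 / 2)))"
  proof (unfold of_nat_sum, rule sum_mono)
    fix C
    have "real (card (Bad C)) \<le> card (Bf C) * (2 * 2 ^ CARD('k) * exp (- L\<^sup>2 / 2))"
      unfolding Bad_def using Bf[of C] L(1) by (intro card_signvecs_exists_abs_inner_ge) auto
    also have "\<dots> \<le> 2 * (2 * 2 ^ CARD('k) * exp (- L\<^sup>2 / 2))"
      using Bf[of C] by (intro mult_right_mono) auto
    finally show "real (card (Bad C)) \<le> 2 * (2 * 2 ^ CARD('k) * exp (- L\<^sup>2 / 2))" .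
  qed
  finally show ?thesis
    using F(2) unfolding L(2) by (simp add: divide_le_eq mult_ac)
qed

section \<open>The probability bound\<close>

lemma rank_eq_2_if_in_Nset_2:
  assumes "Nset S 1 \<inter> Mset = {0}" and "X \<in> Nset S 2 \<inter> Mset - {0}"
  shows "rank X = 2"
proof -
  have X: "rank X \<le> 2" "X \<in> Mset" "X \<noteq> 0" "liftS S X = 0"
    using assms(2) by (simp_all add: Nset_def)
  have "\<not> rank X \<le> 1"
  proof
    assume "rank X \<le> 1"
    then have "X \<in> Nset S 1 \<inter> Mset"
      using X by (simp add: Nset_def)
    then show False
      using assms(1) X(3) by (metis singletonD)
  qed
  then show ?thesis
    using X(1) by simp
qed

lemma prob_pmf_of_set_Times_ge:
  assumes A: "finite A" "A \<noteq> {}" and B: "finite B" "B \<noteq> {}"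
    and bad: "(A \<times> B) - P \<subseteq> A' \<times> B'" "A' \<subseteq> A" "B' \<subseteq> B"
  shows "measure_pmf.prob (pmf_of_set (A \<times> B)) P \<ge> 1 - card A' / card A * (card B' / card B)"
proof -
  have "finite A'" "finite B'"
    using bad(2,3) A(1) B(1) by (simp_all add: finite_subset)
  then have "card (A \<times> B) \<le> card ((A \<times> B) \<inter> P) + card (A' \<times> B')"
    using bad(1) A(1) B(1) by (intro order_trans[OF card_mono card_Un_le]) auto
  then have "real (card A * card B) \<le> real (card ((A \<times> B) \<inter> P) + card A' * card B')"
    unfolding card_cartesian_product by (simp only: of_nat_le_iff)
  then have "(real (card A * card B) - card A' * card B') / card (A \<times> B)
      \<le> card ((A \<times> B) \<inter> P) / card (A \<times> B)"
    by (intro divide_right_mono) simp_all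
  then have "1 - card A' / card A * (card B' / card B) \<le> card ((A \<times> B) \<inter> P) / card (A \<times> B)"
    using A B by (simp add: card_cartesian_product diff_divide_distrib)
  also have "\<dots> = measure_pmf.prob (pmf_of_set (A \<times> B)) P"
    using A B by (simp add: measure_pmf_of_set)
  finally show ?thesis .
qed

lemma power2_sqrt_diff_less:
  fixes \<epsilon> \<delta>' :: real
  assumes "0 < \<epsilon>" and "0 < \<delta>'" and "\<delta>' < 1 - 2 * \<epsilon>\<^sup>2"
  shows "(sqrt (1 - \<delta>') - sqrt 2 * \<epsilon>)\<^sup>2 < 1 - 2 * \<epsilon>\<^sup>2"
proof -
  define a where "a = sqrt (1 - \<delta>')"
  define b where "b = sqrt 2 * \<epsilon>"
  have "\<delta>' < 1"
    using assms(3) zero_le_power2[of \<epsilon>] by linarith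
  then have a: "0 \<le> a" "a < 1" "a\<^sup>2 = 1 - \<delta>'"
    using assms(2) by (simp_all add: a_def)
  have b: "0 < b" "b\<^sup>2 = 2 * \<epsilon>\<^sup>2"
    using assms(1) by (simp_all add: b_def power_mult_distrib)
  have "b\<^sup>2 < a\<^sup>2"
    using a(3) b(2) assms(3) by linarith
  then have "b < a"
    using a(1) by (rule power2_less_imp_less)
  then have "(a - b)\<^sup>2 < (1 - b)\<^sup>2"
    using a(2) by (intro power_strict_mono) simp_all
  also have "\<dots> \<le> 1 - b\<^sup>2"
    using \<open>b < a\<close> a(2) b(1) mult_right_mono[of b 1 b]
    by (simp add: power2_eq_square algebra_simps)
  finally show ?thesis
    using b(2) by (simp add: a_def b_def)
qed

lemma prob_signvecs_outside_frame_spans_ge: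
  fixes Gc :: "(real^2^'m) set" and Gr :: "(real^2^'n) set"
  assumes Gc: "Gc \<subseteq> Gset" and Gr: "Gr \<subseteq> Gset" and e: "e > 0" "2 * e\<^sup>2 < 1"
  shows "measure_pmf.prob (pmf_of_set (signvecs \<times> signvecs))
      {(x, y). (\<forall>Y\<in>Gc. x \<notin> colsp Y) \<or> (\<forall>Y\<in>Gr. y \<notin> colsp Y)}
    \<ge> 1 - 16 * real (covnum Gc ((*\<^sub>R) e ` Dset) * covnum Gr ((*\<^sub>R) e ` Dset))
        * exp (- (real CARD('m) + real CARD('n)) * (1 - 2 * e\<^sup>2) / 4)"
proof -
  define t where "t = 1 - 2 * e\<^sup>2"
  define Nc where "Nc = covnum Gc ((*\<^sub>R) e ` Dset)"
  define Nr where "Nr = covnum Gr ((*\<^sub>R) e ` Dset)"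
  define Bc where "Bc = {x \<in> signvecs. \<exists>Y\<in>Gc. x \<in> colsp Y}"
  define Br where "Br = {y \<in> signvecs. \<exists>Y\<in>Gr. y \<in> colsp Y}"
  have c: "card Bc / 2 ^ CARD('m) \<le> 4 * real Nc * exp (- (real CARD('m) * t) / 4)"
    unfolding Bc_def Nc_def t_def by (rule card_signvecs_in_colsp_le[OF Gc e])
  have r: "card Br / 2 ^ CARD('n) \<le> 4 * real Nr * exp (- (real CARD('n) * t) / 4)"
    unfolding Br_def Nr_def t_def by (rule card_signvecs_in_colsp_le[OF Gr e])
  have "1 - 16 * real (Nc * Nr) * exp (- (real CARD('m) + real CARD('n)) * t / 4)
      = 1 - (4 * Nc * exp (- (real CARD('m) * t) / 4)) * (4 * Nr * exp (- (real CARD('n) * t) / 4))"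
    by (simp add: exp_add[symmetric] field_simps)
  also have "\<dots> \<le> 1 - card Bc / 2 ^ CARD('m) * (card Br / 2 ^ CARD('n))"
    using c r by (intro diff_left_mono mult_mono) auto
  also have "\<dots> \<le> measure_pmf.prob (pmf_of_set (signvecs \<times> signvecs))
      {(x, y). (\<forall>Y\<in>Gc. x \<notin> colsp Y) \<or> (\<forall>Y\<in>Gr. y \<notin> colsp Y)}"
  proof -
    have "1 - card Bc / card (signvecs :: (real^'m) set) * (card Br / card (signvecs :: (real^'n) set))
        \<le> measure_pmf.prob (pmf_of_set (signvecs \<times> signvecs))
          {(x, y). (\<forall>Y\<in>Gc. x \<notin> colsp Y) \<or> (\<forall>Y\<in>Gr. y \<notin> colsp Y)}"
      by (intro prob_pmf_of_set_Times_ge) (auto simp: Bc_def Br_def finite_signvecs signvecs_ne_empty)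
    then show ?thesis
      by (simp add: card_signvecs)
  qed
  finally show ?thesis
    by (simp add: Nc_def Nr_def t_def)
qed

lemma ex_Gc_colsp_eq:
  fixes S :: "real^'m \<Rightarrow> real^'n \<Rightarrow> real^'q"
  assumes "Nset S 1 \<inter> Mset = {0}" and X: "X \<in> Nset S 2 \<inter> Mset - {0}"
  shows "\<exists>Y\<in>Gc S. colsp Y = colsp X"
proof -
  obtain Y :: "real^2^'m" where "Y \<in> Gset" "colsp Y = colsp X"
    using Gset_colsp_eq_if_rank_2[OF rank_eq_2_if_in_Nset_2[OF assms]] .
  then show ?thesis
    using X unfolding Gc_def by blast
qed

lemma ex_Gr_colsp_eq_rowsp:
  fixes S :: "real^'m \<Rightarrow> real^'n \<Rightarrow> real^'q"
  assumes "Nset S 1 \<inter> Mset = {0}" and X: "X \<in> Nset S 2 \<inter> Mset - {0}"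
  shows "\<exists>Y\<in>Gr S. colsp Y = rowsp X"
proof -
  have "rank (transpose X) = 2"
    using rank_eq_2_if_in_Nset_2[OF assms] by (simp add: rank_transpose)
  moreover have "colsp (transpose X) = rowsp X"
    by (simp add: colsp_def rowsp_def)
  ultimately obtain Y :: "real^2^'n" where "Y \<in> Gset" "colsp Y = rowsp X"
    using Gset_colsp_eq_if_rank_2 by metis
  then show ?thesis
    using X unfolding Gr_def by blast
qed

lemma outside_frame_spans_subset:
  fixes S :: "real^'m \<Rightarrow> real^'n \<Rightarrow> real^'q"
  assumes "Nset S 1 \<inter> Mset = {0}"
  shows "{(x, y). (\<forall>Y\<in>Gc S. x \<notin> colsp Y) \<or> (\<forall>Y\<in>Gr S. y \<notin> colsp Y)}
    \<subseteq> {(x, y). \<forall>X \<in> Nset S 2 \<inter> Mset - {0}. x \<notin> colsp X \<or> y \<notin> rowsp X}"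
proof
  fix p
  assume "p \<in> {(x, y). (\<forall>Y\<in>Gc S. x \<notin> colsp Y) \<or> (\<forall>Y\<in>Gr S. y \<notin> colsp Y)}"
  then show "p \<in> {(x, y). \<forall>X \<in> Nset S 2 \<inter> Mset - {0}. x \<notin> colsp X \<or> y \<notin> rowsp X}"
    using ex_Gc_colsp_eq[OF assms] ex_Gr_colsp_eq_rowsp[OF assms] by fastforce
qed

theorem theorem4:
  fixes S :: "real^'m \<Rightarrow> real^'n \<Rightarrow> real^'q"
    and \<epsilon> \<delta>' \<delta> :: real
  assumes bil: "bilinear S"
    and inj1: "Nset S 1 \<inter> Mset = {0}"
    and nonempty: "Nset S 2 \<inter> Mset - {0} \<noteq> {}"
    and eps: "0 < \<epsilon>" "\<epsilon> < 1"
    and dp: "0 < \<delta>'" "\<delta>' < 1 - 2 * \<epsilon>^2"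
    and d_def: "\<delta> = 1 - (sqrt (1 - \<delta>') - sqrt 2 * \<epsilon>)^2"
  shows "measure_pmf.prob (pmf_of_set (signvecs \<times> signvecs))
           {(x, y). \<forall>X \<in> Nset S 2 \<inter> Mset - {0}. x \<notin> colsp X \<or> y \<notin> rowsp X}
         > 1 - 16 * real (covnum (Gc S) ((*\<^sub>R) \<epsilon> ` Dset) * covnum (Gr S) ((*\<^sub>R) \<epsilon> ` Dset))
               * exp (- (real CARD('m) + real CARD('n)) * (1 - \<delta>) / 4)"
proof -
  define N where "N = real (covnum (Gc S) ((*\<^sub>R) \<epsilon> ` Dset) * covnum (Gr S) ((*\<^sub>R) \<epsilon> ` Dset))"
  have frames: "Gc S \<subseteq> Gset" "Gr S \<subseteq> Gset"
    by (auto simp: Gc_def Gr_def)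
  obtain X where X: "X \<in> Nset S 2 \<inter> Mset - {0}"
    using nonempty by blast
  have "Gc S \<noteq> {}" "Gr S \<noteq> {}"
    using ex_Gc_colsp_eq[OF inj1 X] ex_Gr_colsp_eq_rowsp[OF inj1 X] by auto
  then have "N > 0"
    unfolding N_def using frames eps(1)
    by (simp add: covnum_pos bounded_subset[OF bounded_Gset])
  moreover have "(sqrt (1 - \<delta>') - sqrt 2 * \<epsilon>)\<^sup>2 < 1 - 2 * \<epsilon>\<^sup>2" and "0 < real CARD('m) + real CARD('n)"
    using power2_sqrt_diff_less[OF eps(1) dp] by (simp_all add: add_pos_pos)
  ultimately have "1 - 16 * N * exp (- (real CARD('m) + real CARD('n)) * (1 - \<delta>) / 4)
      < 1 - 16 * N * exp (- (real CARD('m) + real CARD('n)) * (1 - 2 * \<epsilon>\<^sup>2) / 4)"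
    by (simp add: d_def)
  also have "\<dots> \<le> measure_pmf.prob (pmf_of_set (signvecs \<times> signvecs))
      {(x, y). (\<forall>Y\<in>Gc S. x \<notin> colsp Y) \<or> (\<forall>Y\<in>Gr S. y \<notin> colsp Y)}"
    unfolding N_def using frames eps(1) dp by (intro prob_signvecs_outside_frame_spans_ge) auto
  also have "\<dots> \<le> measure_pmf.prob (pmf_of_set (signvecs \<times> signvecs))
      {(x, y). \<forall>X \<in> Nset S 2 \<inter> Mset - {0}. x \<notin> colsp X \<or> y \<notin> rowsp X}"
    by (intro measure_pmf.finite_measure_mono outside_frame_spans_subset[OF inj1]) simp
  finally show ?thesis
    unfolding N_def .
qed

end
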